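(* Let $\tilde\Gamma$ be a path on the fixed-point bundle $E$ of ${\rm VI}(F,\Delta)$ with finitely many segments, ending at $(\sigma^\star,\mathbf 0)$, with $\tilde\Gamma\cap S\subseteq\{(\sigma^\star,\mathbf 0)\}$; let $\zeta\ge0$, with $\zeta\ne0$ if $J(\sigma^\star)$ is singular, and let $d>0$ be such that $\mathcal N_{\tilde\Gamma}(\zeta)\cap S=\varnothing$. Assume that $F\in C^2(p_\Delta(\mathcal N_{\tilde\Gamma}(\zeta)))$. Let $\theta_{k+1}=\theta_k+\overline{d\theta}_k$, $\sigma_k={\rm softmax}(\theta_k)$, $\sigma_{k+1}={\rm softmax}(\theta_{k+1})$, where $\overline{d\theta}_k$ is given by the Newton equation $$\left(J(\sigma_k)+(\mathbf 1^\top\mu)I\right)\overline{d\theta}_k=-(I-\mathbf 1\sigma_k^\top)(F(\sigma_k)-\mu/\sigma_k).$$ Then there exists $C_1>0$ such that for any $(\sigma_k,\mu)\in\mathcal N_{\tilde\Gamma}(\zeta)$, $$\left\|\tilde G(\sigma_{k+1},\mu)\right\|\le C_1\left\|\tilde G(\sigma_k,\mu)\right\|^2 .$$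
   Context: Notation. $\Delta=\{\sigma\in\mathbb R^n:\sigma\ge0,\ \mathbf 1^\top\sigma=1\}$, $\mathbf 1$ the all-ones vector. Vector inequalities, $\circ$, $/$ and $\ln$ are componentwise; for a matrix $A$ and vector $b$, $A\circ b=A\,{\rm diag}(b)$ and $b\circ A={\rm diag}(b)A$. $\|\cdot\|$ is the Euclidean norm. ${\rm softmax}(\theta)=\exp(\theta)/(\mathbf 1^\top\exp(\theta))$. $F:\Delta\to\mathbb R^n$ is continuously differentiable (with a $C^1$ extension to a neighborhood of $\Delta$). Bundle. $G(\sigma,\mu)=(I-\sigma\mathbf 1^\top)(\sigma\circ F(\sigma)-\mu)$; $\tilde G(\sigma,\mu)=G(\sigma,\mu)/\sigma$ for $\sigma>0$; $E=\{(\sigma,\mu)\in\Delta\times\mathbb R^n:G(\sigma,\mu)=0\}=\{(\sigma,\sigma\circ F(\sigma)+v\sigma):\sigma\in\Delta,\ v\in\mathbb R\}$; $\tilde\mu(\sigma)=(I-\sigma\mathbf 1^\top)(\sigma\circ F(\sigma))$. $$J(\sigma)=(I-\mathbf 1\sigma^\top)\left(\frac{\partial F(\sigma)}{\partial\sigma}\circ\sigma+\left((I-\mathbf 1\sigma^\top)F(\sigma)\right)\circ I\right)(I-\mathbf 1\sigma^\top)+k\mathbf 1\sigma^\top,$$ where the scalar in the last term (written $k$, unrelated to the iteration index) is fixed, nonzero, and such that $k+\mathbf 1^\top\mu\ne0$ for all $(\sigma,\mu)\in\mathcal N_{\tilde\Gamma}(\zeta)$. The subspace $\ker(\sigma^\top)$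 is $J(\sigma)$-invariant; let $\lambda_j^\perp(J(\sigma))$ be the real eigenvalues of $J(\sigma)$ other than the eigenvalue $k$ belonging to the eigenvector $\mathbf 1$, i.e. the real eigenvalues of $J(\sigma)|_{\ker(\sigma^\top)}$. The singular manifold is $S=\{(\sigma,\tilde\mu(\sigma)-\lambda_j^\perp(J(\sigma))\sigma):\lambda_j^\perp(J(\sigma))\in\mathbb R,\ \sigma\in\Delta\}$. Path. Given $\sigma_{\rm init}\in\Delta$ with positive entries and sufficiently large $v_{\rm init}$, a path is a set $$\tilde\Gamma=\bigcup_{i=1}^q\{(\sigma,\gamma\mu_i)\in E:\ \mu_i=\gamma_{i-1}\mu_{i-1}+\beta_i\sigma_{i-1},\ \gamma\in[\gamma_i,1]\},$$ with $\gamma_0\mu_0=v_{\rm init}\sigma_{\rm init}$, $(\sigma_0,\gamma_0\mu_0)\in E$, $\beta_i\in\mathbb R$, $\mu_i>0$ and $\gamma_q\mathbf 1^\top\mu_q=0$. Here the $i$-th segment is a curve: $\sigma$ is a continuous function of $\gamma\in[\gamma_i,1]$ that equals $\sigma_{i-1}$ at $\gamma=1$ and $\sigma_i$ at $\gamma=\gamma_i$. The end point is $(\sigma^\star,\mathbf 0)$, where $\sigma^\star=\sigma_q$ is a solution of ${\rm VI}(F,\Delta)$ (i.e. $\langle F(\sigma^\star),\sigma'-\sigma^\star\rangle\ge0$ for all $\sigma'\in\Delta$). Neighborhood. $\mathcal N_{\tilde\Gamma}(\zeta)$ is the closure of $\{({\rm softmax}(\theta),\mu):\|\theta-\ln\sigma_\mu\|\le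 d,\ (\sigma_\mu,\mu)\in\tilde\Gamma,\ \mathbf 1^\top\mu>\zeta\}$, and $p_\Delta(\mathcal N_{\tilde\Gamma}(\zeta))$ is its projection to the $\sigma$-space. $F\in C^m(X)$ means that $F$ has continuous derivatives up to order $m$ on $X$.
   Formalization: Added assumption: the Newton equation is uniquely solvable (J(σ)+(1ᵀμ)I is nonsingular) at every point of the closed neighborhood N. Since S lies in E, N∩S=∅ does not imply this, and without it the claim fails for large d (e.g. n=2, F=(a,0), a>0). *)

theory Defs
  imports "HOL-Analysis.Analysis"
begin

text \<open>
  On \<^typ>\<open>real ^ 'n\<close>, \<^term>\<open>x * y\<close> is the componentwise product and \<^term>\<open>1\<close> is the
  all-ones vector, so \<^term>\<open>1 \<bullet> \<mu>\<close> is the sum of the entries of \<^term>\<open>\<mu>\<close>. On square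
  matrices \<^term>\<open>A ** B\<close> is the matrix product and \<^term>\<open>mat 1\<close> the identity.
\<close>

definition vdiv :: "real ^ 'n \<Rightarrow> real ^ 'n \<Rightarrow> real ^ 'n" where
  "vdiv x y = (\<chi> i. x $ i / y $ i)"

definition vln :: "real ^ 'n \<Rightarrow> real ^ 'n" where
  "vln x = (\<chi> i. ln (x $ i))"

definition softmax :: "real ^ 'n \<Rightarrow> real ^ 'n" where
  "softmax \<theta> = (\<chi> i. exp (\<theta> $ i) / (\<Sum>j\<in>UNIV. exp (\<theta> $ j)))"

definition outer :: "real ^ 'n \<Rightarrow> real ^ 'n \<Rightarrow> real ^ 'n ^ 'n" where
  "outer u v = (\<chi> i j. u $ i * v $ j)"

definition diag :: "real ^ 'n \<Rightarrow> real ^ 'n ^ 'n" where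
  "diag b = (\<chi> i j. if i = j then b $ i else 0)"

definition Simp :: "(real ^ 'n) set" where
  "Simp = {\<sigma>. (\<forall>i. 0 \<le> \<sigma> $ i) \<and> 1 \<bullet> \<sigma> = 1}"

definition VI_solution :: "(real ^ 'n \<Rightarrow> real ^ 'n) \<Rightarrow> real ^ 'n \<Rightarrow> bool" where
  "VI_solution F \<sigma> \<longleftrightarrow> \<sigma> \<in> Simp \<and> (\<forall>\<sigma>'\<in>Simp. 0 \<le> F \<sigma> \<bullet> (\<sigma>' - \<sigma>))"

definition C1_on :: "'a::real_normed_vector set \<Rightarrow> ('a \<Rightarrow> 'b::real_normed_vector) \<Rightarrow> bool" where
  "C1_on U f \<longleftrightarrow> open U \<and>
     (\<exists>f' :: 'a \<Rightarrow> 'a \<Rightarrow>\<^sub>L 'b.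
        (\<forall>x\<in>U. (f has_derivative blinfun_apply (f' x)) (at x)) \<and> continuous_on U f')"

definition C2_on :: "'a::real_normed_vector set \<Rightarrow> ('a \<Rightarrow> 'b::real_normed_vector) \<Rightarrow> bool" where
  "C2_on U f \<longleftrightarrow> open U \<and>
     (\<exists>f' :: 'a \<Rightarrow> 'a \<Rightarrow>\<^sub>L 'b.
        (\<forall>x\<in>U. (f has_derivative blinfun_apply (f' x)) (at x)) \<and> C1_on U f')"

text \<open>
  Subsets of the simplex have empty interior in the ambient space, so smoothness on such a
  set is smoothness on an open neighborhood of it.
\<close>

definition C1_near :: "'a::real_normed_vector set \<Rightarrow> ('a \<Rightarrow> 'b::real_normed_vector) \<Rightarrow> bool" where
  "C1_near X f \<longleftrightarrow> (\<exists>U. X \<subseteq> U \<and> C1_on U f)"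

definition C2_near :: "'a::real_normed_vector set \<Rightarrow> ('a \<Rightarrow> 'b::real_normed_vector) \<Rightarrow> bool" where
  "C2_near X f \<longleftrightarrow> (\<exists>U. X \<subseteq> U \<and> C2_on U f)"

definition G :: "(real ^ 'n \<Rightarrow> real ^ 'n) \<Rightarrow> real ^ 'n \<Rightarrow> real ^ 'n \<Rightarrow> real ^ 'n" where
  "G F \<sigma> \<mu> = (mat 1 - outer \<sigma> 1) *v (\<sigma> * F \<sigma> - \<mu>)"

text \<open>Meaningful only where all entries of \<^term>\<open>\<sigma>\<close> are positive.\<close>

definition Gt :: "(real ^ 'n \<Rightarrow> real ^ 'n) \<Rightarrow> real ^ 'n \<Rightarrow> real ^ 'n \<Rightarrow> real ^ 'n" where
  "Gt F \<sigma> \<mu> = vdiv (G F \<sigma> \<mu>) \<sigma>"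

definition E :: "(real ^ 'n \<Rightarrow> real ^ 'n) \<Rightarrow> ((real ^ 'n) \<times> (real ^ 'n)) set" where
  "E F = {(\<sigma>, \<mu>). \<sigma> \<in> Simp \<and> G F \<sigma> \<mu> = 0}"

definition mu_tilde :: "(real ^ 'n \<Rightarrow> real ^ 'n) \<Rightarrow> real ^ 'n \<Rightarrow> real ^ 'n" where
  "mu_tilde F \<sigma> = (mat 1 - outer \<sigma> 1) *v (\<sigma> * F \<sigma>)"

definition J :: "(real ^ 'n \<Rightarrow> real ^ 'n) \<Rightarrow> real \<Rightarrow> real ^ 'n \<Rightarrow> real ^ 'n ^ 'n" where
  "J F k \<sigma> =
     (mat 1 - outer 1 \<sigma>)
       ** (jacobian F (at \<sigma>) ** diag \<sigma> + diag ((mat 1 - outer 1 \<sigma>) *v F \<sigma>))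
       ** (mat 1 - outer 1 \<sigma>)
     + k *\<^sub>R outer 1 \<sigma>"

definition perp_eigenvalues :: "(real ^ 'n \<Rightarrow> real ^ 'n) \<Rightarrow> real \<Rightarrow> real ^ 'n \<Rightarrow> real set" where
  "perp_eigenvalues F k \<sigma> = {l. \<exists>w. w \<noteq> 0 \<and> \<sigma> \<bullet> w = 0 \<and> J F k \<sigma> *v w = l *\<^sub>R w}"

definition S :: "(real ^ 'n \<Rightarrow> real ^ 'n) \<Rightarrow> real \<Rightarrow> ((real ^ 'n) \<times> (real ^ 'n)) set" where
  "S F k = {(\<sigma>, mu_tilde F \<sigma> - l *\<^sub>R \<sigma>) | \<sigma> l. \<sigma> \<in> Simp \<and> l \<in> perp_eigenvalues F k \<sigma>}"

text \<open>
  The set \<^term>\<open>\<Gamma>\<close> is a path with finitely many segments ending at \<^term>\<open>(\<sigma>star, 0)\<close>.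
  The function \<^term>\<open>c i\<close> parametrizes the \<^term>\<open>i\<close>-th segment by \<^term>\<open>\<gamma>\<close>; a segment is
  the graph of this continuous selection, not all of the fiber of \<^term>\<open>E F\<close> over the ray
  (the fiber over \<^term>\<open>0\<close> contains every vertex of the simplex). Only the product
  \<^term>\<open>\<gamma> 0 *\<^sub>R \<mu> 0\<close> is constrained. Of the requirement that \<^term>\<open>v_init\<close> be sufficiently
  large, only positivity is imposed.
\<close>

definition path_on_bundle ::
  "(real ^ 'n \<Rightarrow> real ^ 'n) \<Rightarrow> ((real ^ 'n) \<times> (real ^ 'n)) set \<Rightarrow> real ^ 'n \<Rightarrow> bool" where
  "path_on_bundle F \<Gamma> \<sigma>star \<longleftrightarrow>
    (\<exists>(q::nat) \<sigma>_init (v_init::real) (\<gamma> :: nat \<Rightarrow> real) (\<beta> :: nat \<Rightarrow> real)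
       (\<mu> :: nat \<Rightarrow> real ^ 'n) (\<sigma> :: nat \<Rightarrow> real ^ 'n) (c :: nat \<Rightarrow> real \<Rightarrow> real ^ 'n).
       1 \<le> q \<and>
       \<sigma>_init \<in> Simp \<and> (\<forall>j. 0 < \<sigma>_init $ j) \<and> 0 < v_init \<and>
       \<gamma> 0 *\<^sub>R \<mu> 0 = v_init *\<^sub>R \<sigma>_init \<and>
       (\<sigma> 0, \<gamma> 0 *\<^sub>R \<mu> 0) \<in> E F \<and>
       (\<forall>i\<in>{1..q}.
          \<mu> i = \<gamma> (i - 1) *\<^sub>R \<mu> (i - 1) + \<beta> i *\<^sub>R \<sigma> (i - 1) \<and>
          (\<forall>j. 0 < \<mu> i $ j) \<and>
          \<gamma> i \<le> 1 \<and>
          continuous_on {\<gamma> i..1} (c i) \<and>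
          c i 1 = \<sigma> (i - 1) \<and> c i (\<gamma> i) = \<sigma> i \<and>
          (\<forall>g\<in>{\<gamma> i..1}. (c i g, g *\<^sub>R \<mu> i) \<in> E F)) \<and>
       \<gamma> q * (1 \<bullet> \<mu> q) = 0 \<and>
       \<sigma>star = \<sigma> q \<and> VI_solution F \<sigma>star \<and>
       \<Gamma> = (\<Union>i\<in>{1..q}. {(c i g, g *\<^sub>R \<mu> i) | g. g \<in> {\<gamma> i..1}}))"

text \<open>
  Points of a path with \<^term>\<open>1 \<bullet> \<mu> > 0\<close> have positive entries in both components, so for
  \<^term>\<open>\<zeta> \<ge> 0\<close> the logarithm below is only taken of positive numbers.
\<close>

definition Nbhd ::
  "((real ^ 'n) \<times> (real ^ 'n)) set \<Rightarrow> real \<Rightarrow> real \<Rightarrow> ((real ^ 'n) \<times> (real ^ 'n)) set" where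
  "Nbhd \<Gamma> d \<zeta> = closure {(softmax \<theta>, \<mu>) | \<theta> \<mu> \<sigma>\<mu>.
      norm (\<theta> - vln \<sigma>\<mu>) \<le> d \<and> (\<sigma>\<mu>, \<mu>) \<in> \<Gamma> \<and> 1 \<bullet> \<mu> > \<zeta>}"

definition newton_equation ::
  "(real ^ 'n \<Rightarrow> real ^ 'n) \<Rightarrow> real \<Rightarrow> real ^ 'n \<Rightarrow> real ^ 'n \<Rightarrow> real ^ 'n \<Rightarrow> bool" where
  "newton_equation F k \<sigma> \<mu> \<delta> \<longleftrightarrow>
     (J F k \<sigma> + (1 \<bullet> \<mu>) *\<^sub>R mat 1) *v \<delta> = - ((mat 1 - outer 1 \<sigma>) *v (F \<sigma> - vdiv \<mu> \<sigma>))"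

text \<open>
  The step \<^term>\<open>D\<close> is given by the Newton equation on \<^term>\<open>N\<close>: it is the solution of that
  equation at every point of \<^term>\<open>N\<close>. Unique solvability is thus part of this notion, and
  is equivalent to regularity of \<^term>\<open>J F k \<sigma> + (1 \<bullet> \<mu>) *\<^sub>R mat 1\<close> whatever the right-hand
  side. It does not follow from disjointness of \<^term>\<open>N\<close> and \<^term>\<open>S F k\<close>: since
  \<^term>\<open>S F k \<subseteq> E F\<close>, that condition excludes singular matrices only at points of
  \<^term>\<open>N \<inter> E F\<close>, and \<^term>\<open>N\<close> is not contained in \<^term>\<open>E F\<close>.
\<close>

definition given_by_newton_equation ::
  "(real ^ 'n \<Rightarrow> real ^ 'n) \<Rightarrow> real \<Rightarrow> ((real ^ 'n) \<times> (real ^ 'n)) set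
    \<Rightarrow> (real ^ 'n \<Rightarrow> real ^ 'n \<Rightarrow> real ^ 'n) \<Rightarrow> bool" where
  "given_by_newton_equation F k N D \<longleftrightarrow>
     (\<forall>(\<sigma>, \<mu>)\<in>N. \<forall>\<delta>. newton_equation F k \<sigma> \<mu> \<delta> \<longleftrightarrow> \<delta> = D \<sigma> \<mu>)"

end

theory Submission
  imports Defs
begin

text \<open>
  Write \<open>g = Gt F \<sigma> \<mu>\<close> and \<open>m = \<mu> / \<sigma>\<close>, so that \<open>g\<close> is the right-hand side of the Newton
  equation up to sign. In the logarithmic coordinate \<open>\<theta>\<close>, the derivative of \<open>g\<close> in a direction
  \<open>\<delta>\<close> with \<open>\<sigma> \<bullet> \<delta> = 0\<close> is the Newton matrix applied to \<open>\<delta>\<close>, minus \<open>g * \<delta>\<close>. The Newton step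
  satisfies \<open>\<sigma> \<bullet> \<delta> = 0\<close> because \<open>k + 1 \<bullet> \<mu> \<noteq> 0\<close>, so after the step only \<open>- g * \<delta>\<close> and a
  second-order remainder are left. The neighborhood is compact and the Newton matrix is regular on
  it, hence \<open>norm \<delta>\<close> is at most a constant times \<open>norm g\<close>. The remainder is uniformly quadratic,
  even where \<open>\<sigma>\<close> approaches the boundary of the simplex, because \<open>m\<close> stays bounded: on the path
  \<open>m = F \<sigma> + v 1\<close>, and softmax perturbations by at most \<open>d\<close> change the entries of \<open>\<sigma>\<close> by bounded
  factors.
\<close>

section \<open>Matrix-vector algebra and closed forms of \<open>J\<close> and
  \<open>Gt\<close>\<close>

lemma diag_mult_vec: "diag b *v x = b * x"
  by (simp add: vec_eq_iff matrix_vector_mult_def diag_def if_distrib[of "\<lambda>t. t * _"] cong: if_cong)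

lemma outer_mult_vec: "outer u v *v x = (v \<bullet> x) *\<^sub>R u"
  by (simp add: vec_eq_iff matrix_vector_mult_def outer_def inner_vec_def sum_distrib_left
      algebra_simps)

lemma one_minus_outer_mult_vec: "(mat 1 - outer u v) *v x = x - (v \<bullet> x) *\<^sub>R u"
  by (simp add: matrix_vector_mult_diff_rdistrib outer_mult_vec)

lemma inner_mult_shift: "x \<bullet> (y * z) = (x * y) \<bullet> (z :: real ^ 'n)"
  by (simp add: inner_vec_def mult.assoc)

lemma inner_mult_left_one: "1 \<bullet> (x * y) = x \<bullet> (y :: real ^ 'n)"
  by (simp add: inner_vec_def)

lemma norm_times_vec_le: "norm (x * y :: real ^ 'n) \<le> norm x * norm y"
proof -
  have "norm (x * y) \<le> norm (norm x *\<^sub>R y)"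
    by (rule norm_le_componentwise_cart)
      (simp add: abs_mult mult_right_mono component_le_norm_cart)
  then show ?thesis by simp
qed

text \<open>Trades the matrix for the derivative map \<open>F'\<close>, whose continuity, norm
  bounds and Taylor expansion are what the estimates use.\<close>

lemma J_mult_vec:
  assumes "(F has_derivative F') (at \<sigma>)"
  shows "J F k \<sigma> *v x =
    (let w = x - (\<sigma> \<bullet> x) *\<^sub>R 1; y = F' (\<sigma> * w) + (F \<sigma> - (\<sigma> \<bullet> F \<sigma>) *\<^sub>R 1) * w
     in y - (\<sigma> \<bullet> y) *\<^sub>R 1 + (k * (\<sigma> \<bullet> x)) *\<^sub>R 1)"
proof -
  have "jacobian F (at \<sigma>) *v z = F' z" for z
    using assms has_derivative_linear[OF assms]
    by (simp add: jacobian_def frechet_derivative_at[symmetric] matrix_works linear_matrix_vector_mul_eq)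
  then show ?thesis
    by (simp add: J_def Let_def matrix_vector_mult_add_rdistrib one_minus_outer_mult_vec diag_mult_vec
        outer_mult_vec matrix_vector_mul_assoc[symmetric] scaleR_matrix_vector_assoc[symmetric])
qed

text \<open>Conjugation by \<open>diag \<sigma>\<close> turns
  \<open>mat 1 - outer \<sigma> 1\<close> into \<open>mat 1 - outer 1 \<sigma>\<close>, so
  \<open>Gt\<close> is the negative of the right-hand side of the Newton equation.\<close>

lemma Gt_eq:
  assumes "\<And>i. 0 < \<sigma> $ i"
  shows "Gt F \<sigma> \<mu> = (F \<sigma> - vdiv \<mu> \<sigma>) - (\<sigma> \<bullet> (F \<sigma> - vdiv \<mu> \<sigma>)) *\<^sub>R 1"
proof -
  have ne: "\<sigma> $ i \<noteq> 0" for i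
    using assms[of i] by simp
  have eq: "\<sigma> * F \<sigma> - \<mu> = \<sigma> * (F \<sigma> - vdiv \<mu> \<sigma>)"
    using ne by (simp add: vec_eq_iff vdiv_def right_diff_distrib)
  have "G F \<sigma> \<mu> = \<sigma> * (F \<sigma> - vdiv \<mu> \<sigma>) - (\<sigma> \<bullet> (F \<sigma> - vdiv \<mu> \<sigma>)) *\<^sub>R \<sigma>"
    unfolding G_def one_minus_outer_mult_vec eq inner_mult_left_one ..
  with ne show ?thesis
    by (simp add: Gt_def vdiv_def vec_eq_iff diff_divide_distrib)
qed

section \<open>Softmax and the simplex\<close>

lemma softmax_pos: "0 < softmax \<theta> $ i"
  by (auto simp: softmax_def intro!: divide_pos_pos sum_pos)

lemma sum_softmax: "(\<Sum>i\<in>UNIV. softmax \<theta> $ i) = 1"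
proof -
  have "(\<Sum>j\<in>UNIV. exp (\<theta> $ j)) > 0"
    by (auto intro: sum_pos)
  then show ?thesis
    by (simp add: softmax_def sum_divide_distrib[symmetric])
qed

lemma softmax_in_Simp: "softmax \<theta> \<in> Simp"
  using sum_softmax[of \<theta>] softmax_pos[of \<theta>]
  by (auto simp: Simp_def inner_vec_def intro: less_imp_le)

text \<open>The normalization of \<open>\<theta>\<close> cancels, so a shift of the logits acts on
  \<open>softmax \<theta>\<close> by relative factors; these stay controlled near the boundary of
  the simplex.\<close>

lemma softmax_add:
  "softmax (\<theta> + \<delta>) $ i
    = softmax \<theta> $ i * exp (\<delta> $ i) / (\<Sum>j\<in>UNIV. softmax \<theta> $ j * exp (\<delta> $ j))"
proof -
  have "(\<Sum>j\<in>UNIV. exp (\<theta> $ j)) > 0"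
    by (auto intro: sum_pos)
  moreover have "(\<Sum>j\<in>UNIV. softmax \<theta> $ j * exp (\<delta> $ j))
      = (\<Sum>j\<in>UNIV. exp (\<theta> $ j + \<delta> $ j)) / (\<Sum>j\<in>UNIV. exp (\<theta> $ j))"
    by (simp add: softmax_def exp_add sum_divide_distrib)
  ultimately show ?thesis
    by (simp add: softmax_def exp_add)
qed

lemma softmax_vln:
  assumes "\<And>i. 0 < \<sigma> $ i" "1 \<bullet> \<sigma> = 1"
  shows "softmax (vln \<sigma>) = \<sigma>"
  using assms by (simp add: softmax_def vln_def vec_eq_iff inner_vec_def)

lemma norm_Simp_le_1:
  assumes "\<sigma> \<in> Simp"
  shows "norm \<sigma> \<le> 1"
  using norm_le_l1_cart[of \<sigma>] assms by (simp add: Simp_def inner_vec_def)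

lemma compact_Simp: "compact (Simp :: (real ^ 'n) set)"
proof -
  have "closed (Simp :: (real ^ 'n) set)"
    unfolding Simp_def
    by (intro closed_Collect_conj closed_Collect_all closed_Collect_le closed_Collect_eq
        continuous_intros)
  moreover have "bounded (Simp :: (real ^ 'n) set)"
    using norm_Simp_le_1 by (auto intro: boundedI)
  ultimately show ?thesis
    by (simp add: compact_eq_bounded_closed)
qed

section \<open>Second-order remainders of softmax and of division by it\<close>

text \<open>Lagrange form of the Taylor remainder, with the factor 1/2 dropped. The separate
  \<open>r\<close> lets the norm of a vector serve for all its entries.\<close>

lemma exp_linear_remainder:
  fixes x :: real
  assumes "\<bar>x\<bar> \<le> r" "r \<le> B"
  shows "\<bar>exp x - 1 - x\<bar> \<le> exp B * r\<^sup>2"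
proof -
  obtain t where t: "\<bar>t\<bar> \<le> \<bar>x\<bar>" "exp x = (\<Sum>m<2. x ^ m / fact m) + exp t / fact 2 * x ^ 2"
    using Maclaurin_exp_le[of x 2] by auto
  have eq: "exp x - 1 - x = exp t / 2 * x\<^sup>2"
    using t(2) by (simp add: numeral_2_eq_2)
  have "exp t \<le> exp B" using t(1) assms by simp
  then have "exp t / 2 \<le> exp B" using exp_gt_zero[of t] by linarith
  moreover have "x\<^sup>2 \<le> r\<^sup>2" using assms(1) by (rule abs_le_square_iff[THEN iffD1, OF order_trans]) simp
  ultimately have "exp t / 2 * x\<^sup>2 \<le> exp B * r\<^sup>2" by (intro mult_mono) auto
  moreover have "0 \<le> exp t / 2 * x\<^sup>2" by simp
  ultimately show ?thesis unfolding eq by linarith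
qed

lemma norm_vec_scaled_le:
  fixes x y :: "real ^ 'n"
  assumes "\<And>i. \<bar>x $ i\<bar> \<le> \<bar>y $ i\<bar> * c" and "0 \<le> c"
  shows "norm x \<le> norm y * c"
proof -
  have "norm x \<le> norm (c *\<^sub>R y)"
    by (rule norm_le_componentwise_cart) (use assms in \<open>simp add: abs_mult mult.commute\<close>)
  then show ?thesis using assms(2) by (simp add: mult.commute)
qed

text \<open>The tangent of \<open>exp\<close> at 0 gives the lower bound, the quadratic remainder
  the upper one. In both, \<open>\<sigma> \<bullet> \<delta> = 0\<close> removes the linear term, so
  the softmax normalizer is 1 up to second order.\<close>

lemma weighted_exp_sum_bounds:
  fixes \<sigma> \<delta> :: "real ^ 'n"
  assumes "\<sigma> \<in> Simp" "\<sigma> \<bullet> \<delta> = 0" "norm \<delta> \<le> B"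
  shows "1 \<le> (\<Sum>j\<in>UNIV. \<sigma> $ j * exp (\<delta> $ j))"
    and "(\<Sum>j\<in>UNIV. \<sigma> $ j * exp (\<delta> $ j)) \<le> 1 + exp B * (norm \<delta>)\<^sup>2"
proof -
  have s0: "0 \<le> \<sigma> $ j" for j using assms(1) by (simp add: Simp_def)
  have s1: "(\<Sum>j\<in>UNIV. \<sigma> $ j) = 1" using assms(1) by (simp add: Simp_def inner_vec_def)
  have d0: "(\<Sum>j\<in>UNIV. \<sigma> $ j * \<delta> $ j) = 0" using assms(2) by (simp add: inner_vec_def)
  have "(\<Sum>j\<in>UNIV. \<sigma> $ j * (1 + \<delta> $ j)) \<le> (\<Sum>j\<in>UNIV. \<sigma> $ j * exp (\<delta> $ j))"
    by (intro sum_mono mult_left_mono s0 exp_ge_add_one_self)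
  then show "1 \<le> (\<Sum>j\<in>UNIV. \<sigma> $ j * exp (\<delta> $ j))"
    by (simp add: distrib_left sum.distrib s1 d0)
  have "exp (\<delta> $ j) \<le> 1 + \<delta> $ j + exp B * (norm \<delta>)\<^sup>2" for j
    using exp_linear_remainder[OF component_le_norm_cart[of \<delta> j] assms(3)] by linarith
  then have "(\<Sum>j\<in>UNIV. \<sigma> $ j * exp (\<delta> $ j))
      \<le> (\<Sum>j\<in>UNIV. \<sigma> $ j * (1 + \<delta> $ j + exp B * (norm \<delta>)\<^sup>2))"
    by (intro sum_mono mult_left_mono s0)
  then show "(\<Sum>j\<in>UNIV. \<sigma> $ j * exp (\<delta> $ j)) \<le> 1 + exp B * (norm \<delta>)\<^sup>2"
    by (simp add: distrib_left sum.distrib s1 d0 sum_distrib_right[symmetric])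
qed

text \<open>Orthogonality makes the linear term \<open>softmax \<theta> * \<delta>\<close>, without
  a mean correction. The summand \<open>exp B\<close> pays for the exponential,
  \<open>exp B * exp B\<close> for the normalizer.\<close>

lemma softmax_linear_remainder:
  fixes \<theta> \<delta> :: "real ^ 'n"
  assumes "softmax \<theta> \<bullet> \<delta> = 0" "norm \<delta> \<le> B"
  shows "norm (softmax (\<theta> + \<delta>) - softmax \<theta> - softmax \<theta> * \<delta>)
    \<le> (exp B + exp B * exp B) * (norm \<delta>)\<^sup>2"
proof -
  define s where "s = (\<Sum>j\<in>UNIV. softmax \<theta> $ j * exp (\<delta> $ j))"
  have sp: "softmax (\<theta> + \<delta>) $ i = softmax \<theta> $ i * exp (\<delta> $ i) / s" for i
    by (simp only: softmax_add s_def)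
  note sb = weighted_exp_sum_bounds[OF softmax_in_Simp assms, folded s_def]
  have "norm (softmax (\<theta> + \<delta>) - softmax \<theta> - softmax \<theta> * \<delta>)
    \<le> norm (softmax \<theta>) * ((exp B + exp B * exp B) * (norm \<delta>)\<^sup>2)"
  proof (rule norm_vec_scaled_le)
    fix i
    have le: "\<bar>\<delta> $ i\<bar> \<le> norm \<delta>" by (rule component_le_norm_cart)
    have a: "\<bar>exp (\<delta> $ i) - 1 - \<delta> $ i\<bar> \<le> exp B * (norm \<delta>)\<^sup>2"
      by (rule exp_linear_remainder[OF le assms(2)])
    \<comment> \<open>The error splits into that of the exponential, bounded in \<open>a\<close>,
      and this change caused by the normalizer.\<close>
    have "exp (\<delta> $ i) - exp (\<delta> $ i) / s = exp (\<delta> $ i) * ((s - 1) / s)"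
      using sb(1) by (simp add: field_simps)
    moreover have "0 \<le> (s - 1) / s" "(s - 1) / s \<le> s - 1"
      using sb(1) by (simp_all add: divide_le_eq mult_left_mono[of 1 s "s - 1", simplified])
    moreover have "exp (\<delta> $ i) \<le> exp B" using le assms(2) by simp
    ultimately have "exp (\<delta> $ i) * ((s - 1) / s) \<le> exp B * (exp B * (norm \<delta>)\<^sup>2)"
      "0 \<le> exp (\<delta> $ i) * ((s - 1) / s)" "exp (\<delta> $ i) - exp (\<delta> $ i) / s = exp (\<delta> $ i) * ((s - 1) / s)"
      using sb(2) by (auto intro!: mult_mono simp del: times_divide_eq_right)
    with a have "\<bar>exp (\<delta> $ i) / s - 1 - \<delta> $ i\<bar>
        \<le> exp B * (norm \<delta>)\<^sup>2 + exp B * (exp B * (norm \<delta>)\<^sup>2)"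
      by linarith
    then have "\<bar>exp (\<delta> $ i) / s - 1 - \<delta> $ i\<bar> \<le> (exp B + exp B * exp B) * (norm \<delta>)\<^sup>2"
      by (simp add: algebra_simps)
    moreover have "(softmax (\<theta> + \<delta>) - softmax \<theta> - softmax \<theta> * \<delta>) $ i
        = softmax \<theta> $ i * (exp (\<delta> $ i) / s - 1 - \<delta> $ i)"
      by (simp add: sp right_diff_distrib)
    ultimately show "\<bar>(softmax (\<theta> + \<delta>) - softmax \<theta> - softmax \<theta> * \<delta>) $ i\<bar>
      \<le> \<bar>softmax \<theta> $ i\<bar> * ((exp B + exp B * exp B) * (norm \<delta>)\<^sup>2)"
      by (metis abs_mult mult_left_mono abs_ge_zero)
  qed simp
  also have "\<dots> \<le> 1 * ((exp B + exp B * exp B) * (norm \<delta>)\<^sup>2)"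
    by (intro mult_right_mono norm_Simp_le_1 softmax_in_Simp) simp
  finally show ?thesis by simp
qed

text \<open>Dividing by the shifted softmax multiplies \<open>m\<close> entrywise by
  \<open>exp (- \<delta> $ i) * s\<close>. The error is thus relative to \<open>m\<close> and asks
  for no lower bound on the softmax entries.\<close>

lemma vdiv_softmax_linear_remainder:
  fixes \<theta> \<delta> \<mu> :: "real ^ 'n"
  assumes "softmax \<theta> \<bullet> \<delta> = 0" "norm \<delta> \<le> B"
  defines "m \<equiv> vdiv \<mu> (softmax \<theta>)"
  shows "norm (vdiv \<mu> (softmax (\<theta> + \<delta>)) - (m - m * \<delta>))
    \<le> norm m * ((exp B + exp B * exp B) * (norm \<delta>)\<^sup>2)"
proof -
  define s where "s = (\<Sum>j\<in>UNIV. softmax \<theta> $ j * exp (\<delta> $ j))"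
  have sp: "softmax (\<theta> + \<delta>) $ i = softmax \<theta> $ i * exp (\<delta> $ i) / s" for i
    by (simp only: softmax_add s_def)
  note sb = weighted_exp_sum_bounds[OF softmax_in_Simp assms(1,2), folded s_def]
  show ?thesis
  proof (rule norm_vec_scaled_le)
    fix i
    have le: "\<bar>\<delta> $ i\<bar> \<le> norm \<delta>" by (rule component_le_norm_cart)
    have a: "\<bar>exp (- \<delta> $ i) - 1 + \<delta> $ i\<bar> \<le> exp B * (norm \<delta>)\<^sup>2"
      using exp_linear_remainder[of "- \<delta> $ i" "norm \<delta>" B] le assms(2) by simp
    have "exp (- \<delta> $ i) \<le> exp B" using le assms(2) by simp
    then have "exp (- \<delta> $ i) * (s - 1) \<le> exp B * (exp B * (norm \<delta>)\<^sup>2)"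
      "0 \<le> exp (- \<delta> $ i) * (s - 1)"
      using sb by (auto intro!: mult_mono)
    with a have "\<bar>exp (- \<delta> $ i) * s - 1 + \<delta> $ i\<bar>
        \<le> exp B * (norm \<delta>)\<^sup>2 + exp B * (exp B * (norm \<delta>)\<^sup>2)"
      unfolding right_diff_distrib by linarith
    then have "\<bar>exp (- \<delta> $ i) * s - 1 + \<delta> $ i\<bar> \<le> (exp B + exp B * exp B) * (norm \<delta>)\<^sup>2"
      by (simp add: algebra_simps)
    moreover have "(vdiv \<mu> (softmax (\<theta> + \<delta>)) - (m - m * \<delta>)) $ i
        = m $ i * (exp (- \<delta> $ i) * s - 1 + \<delta> $ i)"
      by (simp add: sp m_def vdiv_def exp_minus divide_inverse distrib_left right_diff_distrib)
    ultimately show "\<bar>(vdiv \<mu> (softmax (\<theta> + \<delta>)) - (m - m * \<delta>)) $ i\<bar>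
      \<le> \<bar>m $ i\<bar> * ((exp B + exp B * exp B) * (norm \<delta>)\<^sup>2)"
      by (metis abs_mult mult_left_mono abs_ge_zero)
  qed simp
qed

section \<open>Cancellation of first-order terms by the Newton equation\<close>

text \<open>
  Here \<open>a\<close> stands for \<open>F' (\<sigma> * \<delta>)\<close>. The terms after \<open>g\<close> in the conclusion are the
  first-order change of \<open>g\<close> when \<open>\<sigma>\<close>, \<open>f\<close> and \<open>m\<close> change by \<open>\<sigma> * \<delta>\<close>, \<open>a\<close> and \<open>- m * \<delta>\<close>.
\<close>

lemma newton_cancellation:
  fixes \<sigma> \<delta> a m f :: "real ^ 'n"
  assumes "\<sigma> \<bullet> \<delta> = 0"
  defines "h \<equiv> f - m"
  defines "g \<equiv> h - (\<sigma> \<bullet> h) *\<^sub>R 1"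
  defines "y \<equiv> a + (f - (\<sigma> \<bullet> f) *\<^sub>R 1) * \<delta>"
  defines "e \<equiv> a + m * \<delta>"
  assumes "y - (\<sigma> \<bullet> y) *\<^sub>R 1 + (\<sigma> \<bullet> m) *\<^sub>R \<delta> = - g"
  shows "g + e - (\<sigma> \<bullet> e + (\<sigma> * \<delta>) \<bullet> h) *\<^sub>R 1 = - (g * \<delta>)"
proof -
  have sy: "\<sigma> \<bullet> y = \<sigma> \<bullet> a + (\<sigma> * \<delta>) \<bullet> f"
  proof -
    have "\<sigma> \<bullet> ((f - (\<sigma> \<bullet> f) *\<^sub>R 1) * \<delta>) = (\<sigma> * \<delta>) \<bullet> f - (\<sigma> \<bullet> f) * (\<sigma> \<bullet> \<delta>)"
      unfolding left_diff_distrib inner_diff_right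
      by (simp add: inner_mult_shift mult.commute[of f])
    with assms(1) show ?thesis by (simp add: y_def inner_add_right)
  qed
  \<comment> \<open>The contributions of \<open>m\<close> cancel, so the coefficient of
    \<open>1\<close> in the conclusion is \<open>\<sigma> \<bullet> y\<close>, as in the Newton
    equation.\<close>
  have se: "\<sigma> \<bullet> e + (\<sigma> * \<delta>) \<bullet> h = \<sigma> \<bullet> a + (\<sigma> * \<delta>) \<bullet> f"
    by (simp add: e_def h_def inner_add_right inner_diff_right inner_mult_shift mult.commute[of m])
  have "y $ i - \<sigma> \<bullet> y + (\<sigma> \<bullet> m) * \<delta> $ i = - g $ i" for i
    using arg_cong[OF assms(6), of "\<lambda>v. v $ i"] by simp
  \<comment> \<open>Entrywise, \<open>e\<close> is
    \<open>y + (\<sigma> \<bullet> m) *\<^sub>R \<delta>\<close> minus \<open>g * \<delta>\<close>,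
    and the Newton equation absorbs everything but the last product.\<close>
  then show ?thesis
    unfolding vec_eq_iff se sy
    by (auto simp: y_def e_def g_def h_def inner_diff_right algebra_simps)
qed


section \<open>Uniform estimates on compact sets\<close>

text \<open>
  The second point ranges over all of \<open>A\<close>, where \<open>f\<close> need not be twice differentiable: away from
  the first point the left-hand side is bounded and the quadratic is bounded below.
\<close>

lemma C2_near_taylor_bound:
  fixes f :: "'a::euclidean_space \<Rightarrow> 'b::real_normed_vector"
  assumes K: "compact K" "C2_near K f"
    and A: "compact A" "K \<subseteq> A" "continuous_on A f"
    and f': "\<And>x. x \<in> K \<Longrightarrow> (f has_derivative blinfun_apply (f' x)) (at x)"
  obtains C where "0 \<le> C"
    "\<And>x y. x \<in> K \<Longrightarrow> y \<in> A \<Longrightarrow> norm (f y - f x - f' x (y - x)) \<le> C * (norm (y - x))\<^sup>2"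
proof -
  obtain U f1 where U: "open U" "K \<subseteq> U"
    and f1: "\<And>x. x \<in> U \<Longrightarrow> (f has_derivative blinfun_apply (f1 x)) (at x)"
    and "C1_on U f1"
    using K(2) unfolding C2_near_def C2_on_def by blast
  then obtain f2 where f2: "\<And>x. x \<in> U \<Longrightarrow> (f1 has_derivative blinfun_apply (f2 x)) (at x)"
    and contf2: "continuous_on U f2"
    unfolding C1_on_def by blast
  \<comment> \<open>The given \<open>f'\<close> need only be a derivative on \<open>K\<close>; there
    it agrees with the differentiable witness \<open>f1\<close>.\<close>
  have eq: "f' x = f1 x" if "x \<in> K" for x
    using has_derivative_unique[OF f'[OF that] f1] that U(2) by (simp add: blinfun_apply_inject subset_iff)
  obtain \<epsilon> where \<epsilon>: "0 < \<epsilon>" "(\<Union>x\<in>K. cball x \<epsilon>) \<subseteq> U"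
    using compact_subset_open_imp_cball_epsilon_subset[OF K(1) U] by blast
  \<comment> \<open>A compact thickening of \<open>K\<close> inside \<open>U\<close>: it contains
    all short segments starting in \<open>K\<close>, so a bound on \<open>f2\<close> there covers
    them.\<close>
  define K' where "K' = {x + z | x z. x \<in> K \<and> z \<in> cball 0 \<epsilon>}"
  have "compact K'"
    unfolding K'_def using K(1) by (intro compact_sums) auto
  have in_K': "z \<in> K'" if "x \<in> K" "z \<in> cball x \<epsilon>" for x z
  proof -
    have "z = x + (z - x)" "z - x \<in> cball 0 \<epsilon>"
      using that(2) by (simp_all add: dist_norm norm_minus_commute)
    with that(1) show ?thesis unfolding K'_def by blast
  qed
  have K'_U: "K' \<subseteq> U"
    using \<epsilon>(2) unfolding K'_def by (force simp: dist_norm)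
  have contf1: "continuous_on U f1"
    using f2 by (meson continuous_at_imp_continuous_on has_derivative_continuous)
  have "bounded (f2 ` K')"
    using compact_continuous_image[OF continuous_on_subset[OF contf2 K'_U] \<open>compact K'\<close>]
    by (rule compact_imp_bounded)
  then obtain L where L: "0 < L" "\<And>z. z \<in> K' \<Longrightarrow> norm (f2 z) \<le> L"
    unfolding bounded_pos by auto
  have "bounded (f1 ` K)"
    using compact_continuous_image[OF continuous_on_subset[OF contf1 U(2)] K(1)]
    by (rule compact_imp_bounded)
  then obtain L1 where L1: "0 < L1" "\<And>z. z \<in> K \<Longrightarrow> norm (f1 z) \<le> L1"
    unfolding bounded_pos by auto
  have "bounded (f ` A)"
    using compact_continuous_image[OF A(3,1)] by (rule compact_imp_bounded)
  then obtain L0 where L0: "0 < L0" "\<And>z. z \<in> A \<Longrightarrow> norm (f z) \<le> L0"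
    unfolding bounded_pos by auto
  obtain R where R: "0 < R" "\<And>z. z \<in> A \<Longrightarrow> norm z \<le> R"
    using compact_imp_bounded[OF A(1)] unfolding bounded_pos by auto
  \<comment> \<open>Crude bound on the whole remainder: two values of \<open>f\<close> and one
    application of \<open>f1\<close> to a difference of norm at most \<open>2 * R\<close>.\<close>
  define T where "T = 2 * L0 + L1 * (2 * R)"
  have T: "0 < T" using L0(1) L1(1) R(1) by (simp add: T_def add_pos_pos)
  show thesis
  proof
    show "0 \<le> L + T / \<epsilon>\<^sup>2" using L(1) T by simp
    fix x y assume x: "x \<in> K" and y: "y \<in> A"
    show "norm (f y - f x - f' x (y - x)) \<le> (L + T / \<epsilon>\<^sup>2) * (norm (y - x))\<^sup>2"
    proof (cases "norm (y - x) \<le> \<epsilon>")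
      case True
      define Sg where "Sg = closed_segment x y"
      have "y \<in> cball x \<epsilon>" using True by (simp add: dist_norm norm_minus_commute)
      then have "Sg \<subseteq> cball x \<epsilon>"
        unfolding Sg_def using \<epsilon>(1) by (intro closed_segment_subset) auto
      then have Sg_K': "Sg \<subseteq> K'" using in_K'[OF x] by blast
      then have Sg_U: "Sg \<subseteq> U" using K'_U by blast
      have xS: "x \<in> Sg" by (simp add: Sg_def)
      \<comment> \<open>The mean value bound is applied on the segment because \<open>K'\<close>
        need not be convex.\<close>
      have lip: "norm (f1 z - f1 x) \<le> L * norm (z - x)" if "z \<in> Sg" for z
      proof (rule differentiable_bound[where S = Sg and f' = "\<lambda>z. blinfun_apply (f2 z)"])
        show "convex Sg" by (simp add: Sg_def)
        show "(f1 has_derivative blinfun_apply (f2 w)) (at w within Sg)" if "w \<in> Sg" for w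
          using f2 Sg_U that by (blast intro: has_derivative_at_withinI)
        show "onorm (blinfun_apply (f2 w)) \<le> L" if "w \<in> Sg" for w
          using L(2)[of w] Sg_K' that by (auto simp: norm_blinfun.rep_eq)
      qed (use that xS in auto)
      have "norm (f y - f x - f1 x (y - x)) \<le> norm (y - x) * (L * norm (y - x))"
      proof (rule differentiable_bound_linearization[where S = Sg and f' = "\<lambda>z. blinfun_apply (f1 z)"])
        show "x + t *\<^sub>R (y - x) \<in> Sg" if "t \<in> {0..1}" for t
          using that unfolding Sg_def closed_segment_def by (auto simp: algebra_simps intro!: exI[of _ t])
        show "(f has_derivative blinfun_apply (f1 w)) (at w within Sg)" if "w \<in> Sg" for w
          using f1 Sg_U that by (blast intro: has_derivative_at_withinI)
        show "onorm (blinfun_apply (f1 w) - blinfun_apply (f1 x)) \<le> L * norm (y - x)"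
          if "w \<in> Sg" for w
        proof -
          have "onorm (blinfun_apply (f1 w) - blinfun_apply (f1 x)) = norm (f1 w - f1 x)"
            by (simp add: norm_blinfun.rep_eq minus_blinfun.rep_eq fun_diff_def)
          also have "\<dots> \<le> L * norm (w - x)" by (rule lip[OF that])
          also have "\<dots> \<le> L * norm (y - x)"
            using that L(1) segment_bound(1)[of w x y] by (auto simp: Sg_def)
          finally show ?thesis .
        qed
      qed (rule xS)
      also have "\<dots> = L * (norm (y - x))\<^sup>2" by (simp add: power2_eq_square)
      also have "\<dots> \<le> (L + T / \<epsilon>\<^sup>2) * (norm (y - x))\<^sup>2"
        using T by (intro mult_right_mono) auto
      finally show ?thesis by (simp add: eq[OF x])
    next
      case False
      have xA: "x \<in> A" using x A(2) by blast
      have "norm (f y - f x - f1 x (y - x)) \<le> norm (f y) + norm (f x) + norm (f1 x (y - x))"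
        using norm_triangle_ineq4[of "f y - f x" "f1 x (y - x)"] norm_triangle_ineq4[of "f y" "f x"]
        by linarith
      also have "norm (f1 x (y - x)) \<le> norm (f1 x) * norm (y - x)" by (rule norm_blinfun)
      also have "\<dots> \<le> L1 * (2 * R)"
        using L1 x R(2)[OF y] R(2)[OF xA] norm_triangle_ineq4[of y x]
        by (intro mult_mono) auto
      finally have "norm (f y - f x - f1 x (y - x)) \<le> T * 1"
        using L0(2)[OF y] L0(2)[OF xA] by (simp add: T_def)
      \<comment> \<open>Here \<open>norm (y - x)\<close> exceeds \<open>\<epsilon>\<close>, so the
        quotient is at least 1.\<close>
      also have "\<dots> \<le> T * ((norm (y - x))\<^sup>2 / \<epsilon>\<^sup>2)"
        using T False \<epsilon>(1) by (intro mult_left_mono) (auto simp: power_mono)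
      also have "\<dots> \<le> (L + T / \<epsilon>\<^sup>2) * (norm (y - x))\<^sup>2"
        using L(1) by (simp add: distrib_right)
      finally show ?thesis by (simp add: eq[OF x])
    qed
  qed
qed

text \<open>The norm of \<open>h\<close> attains a positive minimum on \<open>K\<close> times the
  unit sphere; homogeneity carries it to all vectors.\<close>

lemma compact_injective_lower_bound:
  fixes h :: "'a::topological_space \<times> 'b::euclidean_space \<Rightarrow> 'c::real_normed_vector"
  assumes "compact K" "continuous_on (K \<times> UNIV) h"
    and nz: "\<And>x v. x \<in> K \<Longrightarrow> v \<noteq> 0 \<Longrightarrow> h (x, v) \<noteq> 0"
    and hom: "\<And>x v t. x \<in> K \<Longrightarrow> h (x, t *\<^sub>R v) = t *\<^sub>R h (x, v)"
  obtains c where "0 < c" "\<And>x v. x \<in> K \<Longrightarrow> c * norm v \<le> norm (h (x, v))"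
proof (cases "K = {}")
  case True
  then show ?thesis using that[of 1] by simp
next
  case False
  define T where "T = K \<times> sphere (0::'b) 1"
  have "compact T" using assms(1) by (simp add: T_def compact_Times)
  moreover have "T \<noteq> {}" using False by (simp add: T_def)
  moreover have "continuous_on T (\<lambda>z. norm (h z))"
    by (intro continuous_on_norm continuous_on_subset[OF assms(2)]) (auto simp: T_def)
  ultimately obtain z where z: "z \<in> T" "\<And>y. y \<in> T \<Longrightarrow> norm (h z) \<le> norm (h y)"
    using continuous_attains_inf[of T "\<lambda>z. norm (h z)"] by blast
  show ?thesis
  proof
    have "fst z \<in> K" "snd z \<noteq> 0" using z(1) by (auto simp: T_def)
    then show "0 < norm (h z)" using nz[of "fst z" "snd z"] by simp
    fix x v assume x: "x \<in> K"
    show "norm (h z) * norm v \<le> norm (h (x, v))"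
    proof (cases "v = 0")
      case False
      have "h (x, v) = norm v *\<^sub>R h (x, sgn v)"
        using hom[OF x, of "norm v" "sgn v"] by (simp add: sgn_div_norm False)
      moreover have "norm (h z) \<le> norm (h (x, sgn v))"
        using x False by (intro z(2)) (simp add: T_def norm_sgn)
      ultimately show ?thesis by (simp add: mult.commute mult_left_mono)
    qed simp
  qed
qed

section \<open>Bounds on the path and its neighborhood\<close>

text \<open>On the bundle, \<open>\<mu>\<close> is \<open>\<sigma>\<close> times
  \<open>F \<sigma> + v 1\<close> with scalar \<open>v\<close>. Both \<open>F\<close> on the simplex
  and \<open>v\<close> along finitely many segments are bounded, hence so is
  \<open>\<mu> / \<sigma>\<close>.\<close>

lemma path_on_bundle_bounds:
  assumes "path_on_bundle F \<Gamma> \<sigma>star" and "continuous_on Simp F"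
  obtains B where "0 \<le> B"
    "\<And>\<sigma> \<mu>. (\<sigma>, \<mu>) \<in> \<Gamma> \<Longrightarrow> 0 < 1 \<bullet> \<mu> \<Longrightarrow>
      \<sigma> \<in> Simp \<and> (\<forall>i. 0 < \<sigma> $ i) \<and> norm \<mu> \<le> B \<and> (\<forall>i. \<bar>\<mu> $ i\<bar> \<le> B * \<sigma> $ i)"
proof -
  obtain q :: nat and \<gamma> m c where
    \<Gamma>: "\<Gamma> = (\<Union>i\<in>{1..q}. {(c i g, g *\<^sub>R m i) | g. g \<in> {\<gamma> i..1}})"
    and seg: "\<forall>i\<in>{1..q}. (\<forall>j. 0 < m i $ j) \<and> (\<forall>g\<in>{\<gamma> i..1}. (c i g, g *\<^sub>R m i) \<in> E F)"
    using assms(1) unfolding path_on_bundle_def by (elim exE conjE) (rule that, assumption, blast)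
  have m: "0 < m i $ j" if "i \<in> {1..q}" for i j
    using seg that by blast
  have E: "(c i g, g *\<^sub>R m i) \<in> E F" if "i \<in> {1..q}" "g \<in> {\<gamma> i..1}" for i g
    using seg that by blast
  have "bounded (F ` Simp)"
    using compact_continuous_image[OF assms(2) compact_Simp] by (rule compact_imp_bounded)
  then obtain BF where BF: "0 < BF" "\<And>z. z \<in> Simp \<Longrightarrow> norm (F z) \<le> BF"
    unfolding bounded_pos by auto
  define Bm where "Bm = (\<Sum>i\<in>{1..q}. norm (m i))"
  have Bm: "0 \<le> Bm" by (simp add: Bm_def sum_nonneg)
  \<comment> \<open>\<open>2 * BF\<close> covers \<open>F \<sigma> $ j\<close> and
    \<open>\<sigma> \<bullet> F \<sigma>\<close>, the middle term covers
    \<open>1 \<bullet> \<mu>\<close>, and the last makes \<open>B\<close> bound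
    \<open>norm \<mu>\<close> too.\<close>
  define B where "B = 2 * BF + norm (1 :: real ^ 'a) * Bm + Bm"
  show thesis
  proof
    show "0 \<le> B" using BF(1) Bm by (simp add: B_def)
    fix \<sigma> \<mu> assume in_\<Gamma>: "(\<sigma>, \<mu>) \<in> \<Gamma>" and pos: "0 < 1 \<bullet> \<mu>"
    obtain i g where i: "i \<in> {1..q}" "g \<in> {\<gamma> i..1}" and \<sigma>: "\<sigma> = c i g" and \<mu>: "\<mu> = g *\<^sub>R m i"
      using in_\<Gamma> unfolding \<Gamma> by blast
    have "0 < 1 \<bullet> m i"
      using m[OF i(1)] by (auto simp: inner_vec_def intro!: sum_pos)
    \<comment> \<open>Segments may reach nonpositive \<open>g\<close>; positive total mass excludes
      these, and \<open>g \<le> 1\<close> then gives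
      \<open>norm \<mu> \<le> norm (m i)\<close>.\<close>
    then have g: "0 < g" using pos by (simp add: \<mu> zero_less_mult_iff)
    have \<mu>_pos: "0 < \<mu> $ j" for j using g m[OF i(1)] by (simp add: \<mu>)
    have "norm \<mu> \<le> norm (m i)"
      using g i(2) mult_right_mono[of g 1 "norm (m i)"] by (simp add: \<mu>)
    also have "\<dots> \<le> Bm" unfolding Bm_def using i(1) by (intro member_le_sum) auto
    finally have norm_\<mu>: "norm \<mu> \<le> Bm" .
    have Simp: "\<sigma> \<in> Simp" and G0: "G F \<sigma> \<mu> = 0"
      using E[OF i] by (auto simp: E_def \<sigma> \<mu>)
    then have \<sigma>0: "0 \<le> \<sigma> $ j" for j by (simp add: Simp_def)
    have eq: "\<mu> $ j = \<sigma> $ j * (F \<sigma> $ j - (\<sigma> \<bullet> F \<sigma> - 1 \<bullet> \<mu>))" for j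
      using arg_cong[OF G0, of "\<lambda>v. v $ j"] unfolding G_def one_minus_outer_mult_vec
      by (simp add: inner_diff_right inner_mult_left_one algebra_simps)
    \<comment> \<open>By \<open>eq\<close>, a zero entry of \<open>\<sigma>\<close> would force a
      zero entry of \<open>\<mu>\<close>.\<close>
    have pos_\<sigma>: "0 < \<sigma> $ j" for j
      using \<mu>_pos[of j] \<sigma>0[of j] eq[of j] by (cases "\<sigma> $ j = 0") auto
    have bd: "\<bar>\<mu> $ j\<bar> \<le> B * \<sigma> $ j" for j
    proof -
      have "\<bar>F \<sigma> $ j\<bar> \<le> BF" using component_le_norm_cart[of "F \<sigma>" j] BF(2)[OF Simp] by linarith
      moreover have "\<bar>\<sigma> \<bullet> F \<sigma>\<bar> \<le> 1 * BF"
        using Cauchy_Schwarz_ineq2[of \<sigma> "F \<sigma>"] mult_mono[OF norm_Simp_le_1[OF Simp] BF(2)[OF Simp]]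
        by simp
      moreover have "\<bar>1 \<bullet> \<mu>\<bar> \<le> norm (1 :: real ^ 'a) * Bm"
        using Cauchy_Schwarz_ineq2[of 1 \<mu>] mult_left_mono[OF norm_\<mu> norm_ge_zero]
        by (rule order_trans)
      ultimately have "\<bar>F \<sigma> $ j - (\<sigma> \<bullet> F \<sigma> - 1 \<bullet> \<mu>)\<bar> \<le> B"
        using Bm unfolding B_def by linarith
      then show ?thesis
        using \<sigma>0[of j] by (subst eq) (simp add: abs_mult mult.commute[of B] mult_left_mono)
    qed
    have "norm \<mu> \<le> B"
      using norm_\<mu> BF(1) mult_nonneg_nonneg[OF norm_ge_zero[of "1 :: real ^ 'a"] Bm]
      unfolding B_def by linarith
    with Simp pos_\<sigma> bd
    show "\<sigma> \<in> Simp \<and> (\<forall>i. 0 < \<sigma> $ i) \<and> norm \<mu> \<le> B \<and> (\<forall>i. \<bar>\<mu> $ i\<bar> \<le> B * \<sigma> $ i)" by blast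
  qed
qed

text \<open>Each logit moves by at most \<open>d\<close>: the numerator shrinks by at most
  \<open>exp (- d)\<close> and the normalizer grows to at most \<open>exp d\<close>.\<close>

lemma softmax_perturb_ge:
  assumes \<sigma>: "\<sigma> \<in> Simp" "\<And>i. 0 < \<sigma> $ i" and d: "norm (\<theta> - vln \<sigma>) \<le> d"
  shows "\<sigma> $ i \<le> exp (2 * d) * softmax \<theta> $ i"
proof -
  define \<eta> where "\<eta> = \<theta> - vln \<sigma>"
  have s1: "(\<Sum>j\<in>UNIV. \<sigma> $ j) = 1" using \<sigma>(1) by (simp add: Simp_def inner_vec_def)
  have sm: "softmax (vln \<sigma>) = \<sigma>"
    using \<sigma> by (intro softmax_vln) (auto simp: Simp_def)
  have \<eta>: "\<bar>\<eta> $ j\<bar> \<le> d" for j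
    using component_le_norm_cart[of \<eta> j] d by (simp add: \<eta>_def)
  define s where "s = (\<Sum>j\<in>UNIV. \<sigma> $ j * exp (\<eta> $ j))"
  have eq: "softmax \<theta> $ i = \<sigma> $ i * exp (\<eta> $ i) / s"
    using softmax_add[of "vln \<sigma>" \<eta> i] by (simp add: sm s_def \<eta>_def)
  have s0: "0 < s" unfolding s_def using \<sigma>(2) by (intro sum_pos) auto
  have "s \<le> (\<Sum>j\<in>UNIV. \<sigma> $ j * exp d)"
    unfolding s_def using \<eta> \<sigma>(2)
    by (intro sum_mono mult_left_mono) (auto simp: abs_le_iff less_imp_le)
  then have s: "s \<le> exp d" by (simp add: sum_distrib_right[symmetric] s1)
  have "1 = exp d * exp (- d)" by (simp add: exp_minus)
  also have "\<dots> \<le> exp d * exp (\<eta> $ i)" using \<eta>[of i] by (simp add: abs_le_iff)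
  finally have "s * 1 \<le> exp d * (exp d * exp (\<eta> $ i))"
    using s s0 by (intro mult_mono) simp_all
  moreover have "exp d * (exp d * exp (\<eta> $ i)) = exp (2 * d) * exp (\<eta> $ i)"
    by (simp only: mult_2 exp_add mult.assoc)
  ultimately have "1 \<le> exp (2 * d) * exp (\<eta> $ i) / s"
    using s0 by (simp only: le_divide_eq_1_pos mult_1_right)
  then have "\<sigma> $ i * 1 \<le> \<sigma> $ i * (exp (2 * d) * exp (\<eta> $ i) / s)"
    using \<sigma>(2)[of i] by (intro mult_left_mono) auto
  then show ?thesis by (simp add: eq mult_ac)
qed

text \<open>The ratio bound is kept in multiplied form. It is then a closed condition that passes to
  the closure, where entries of \<open>\<sigma>\<close> may vanish.\<close>

lemma Nbhd_bounds:
  assumes "path_on_bundle F \<Gamma> \<sigma>star" and "continuous_on Simp F" and "0 \<le> \<zeta>"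
  obtains B where "0 \<le> B"
    "\<And>\<sigma> \<mu>. (\<sigma>, \<mu>) \<in> Nbhd \<Gamma> d \<zeta> \<Longrightarrow>
      \<sigma> \<in> Simp \<and> norm \<mu> \<le> B \<and> (\<forall>i. \<bar>\<mu> $ i\<bar> \<le> B * \<sigma> $ i)"
proof -
  obtain B0 where B0: "0 \<le> B0" and bd: "\<And>\<sigma> \<mu>. (\<sigma>, \<mu>) \<in> \<Gamma> \<Longrightarrow> 0 < 1 \<bullet> \<mu> \<Longrightarrow>
      \<sigma> \<in> Simp \<and> (\<forall>i. 0 < \<sigma> $ i) \<and> norm \<mu> \<le> B0 \<and> (\<forall>i. \<bar>\<mu> $ i\<bar> \<le> B0 * \<sigma> $ i)"
    using path_on_bundle_bounds[OF assms(1,2)] by metis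
  \<comment> \<open>The first summand bounds \<open>norm \<mu>\<close>, the second the ratio after
    the softmax perturbation; a sum serves both whatever the sign of \<open>d\<close>.\<close>
  define B where "B = B0 + B0 * exp (2 * d)"
  define T :: "((real ^ 'a) \<times> (real ^ 'a)) set"
    where "T = {z. fst z \<in> Simp \<and> norm (snd z) \<le> B \<and> (\<forall>i. \<bar>snd z $ i\<bar> \<le> B * fst z $ i)}"
  have "closed T"
  proof -
    have "closed {z :: (real ^ 'a) \<times> (real ^ 'a). fst z \<in> Simp}"
      using continuous_closed_vimage[OF compact_imp_closed[OF compact_Simp], of fst]
      by (simp add: vimage_def continuous_fst)
    then show ?thesis
      unfolding T_def
      by (intro closed_Collect_conj closed_Collect_all closed_Collect_le continuous_intros)
  qed
  moreover have "{(softmax \<theta>, \<mu>) | \<theta> \<mu> \<sigma>\<mu>.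
      norm (\<theta> - vln \<sigma>\<mu>) \<le> d \<and> (\<sigma>\<mu>, \<mu>) \<in> \<Gamma> \<and> 1 \<bullet> \<mu> > \<zeta>} \<subseteq> T"
  proof clarify
    fix \<theta> \<mu> \<sigma> assume *: "norm (\<theta> - vln \<sigma>) \<le> d" "(\<sigma>, \<mu>) \<in> \<Gamma>" "1 \<bullet> \<mu> > \<zeta>"
    then have b: "\<sigma> \<in> Simp" "\<And>i. 0 < \<sigma> $ i" "norm \<mu> \<le> B0" "\<And>i. \<bar>\<mu> $ i\<bar> \<le> B0 * \<sigma> $ i"
      using bd[of \<sigma> \<mu>] assms(3) by auto
    have "\<bar>\<mu> $ i\<bar> \<le> B * softmax \<theta> $ i" for i
    proof -
      have "\<bar>\<mu> $ i\<bar> \<le> B0 * (exp (2 * d) * softmax \<theta> $ i)"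
        using b(4)[of i] mult_left_mono[OF softmax_perturb_ge[OF b(1,2) *(1), of i] B0] by linarith
      also have "\<dots> \<le> B * softmax \<theta> $ i"
        using B0 softmax_pos[of \<theta> i] by (simp add: B_def distrib_right)
      finally show ?thesis .
    qed
    moreover have "norm \<mu> \<le> B"
      using b(3) B0 by (simp add: B_def add_increasing2)
    ultimately show "(softmax \<theta>, \<mu>) \<in> T"
      by (simp add: T_def softmax_in_Simp)
  qed
  ultimately have "Nbhd \<Gamma> d \<zeta> \<subseteq> T"
    unfolding Nbhd_def by (intro closure_minimal)
  then show thesis
    using B0 by (intro that[of B]) (force simp: T_def B_def)+
qed

section \<open>Second-order remainder of one Newton step\<close>

text \<open>\<open>R\<close>, \<open>q\<close> and \<open>t\<close> are the quadratic coefficients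
  for \<open>\<sigma>\<close>, for \<open>F \<sigma> - \<mu> / \<sigma>\<close> and for the inner
  product of the two. They depend only on a priori bounds, which makes the estimate uniform.\<close>

lemma newton_step_remainder:
  fixes F :: "real ^ 'n \<Rightarrow> real ^ 'n" and \<theta> \<delta> \<mu> :: "real ^ 'n"
    and F' :: "(real ^ 'n) \<Rightarrow>\<^sub>L (real ^ 'n)" and B Bm BF L C :: real
  defines "R \<equiv> exp B + exp B * exp B"
  defines "q \<equiv> L * R + C * (1 + R * B)\<^sup>2 + Bm * R"
  defines "t \<equiv> (L + Bm) + q + R * ((BF + Bm) + (L + Bm) * B)"
  defines "\<sigma> \<equiv> softmax \<theta>" and "\<sigma>' \<equiv> softmax (\<theta> + \<delta>)"
  defines "m \<equiv> vdiv \<mu> \<sigma>"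
  defines "y \<equiv> F' (\<sigma> * \<delta>) + (F \<sigma> - (\<sigma> \<bullet> F \<sigma>) *\<^sub>R 1) * \<delta>"
  assumes orth: "\<sigma> \<bullet> \<delta> = 0" and \<delta>: "norm \<delta> \<le> B"
    and m: "norm m \<le> Bm" and F: "norm (F \<sigma>) \<le> BF" and F': "norm F' \<le> L"
    and C: "0 \<le> C" and taylor: "norm (F \<sigma>' - F \<sigma> - F' (\<sigma>' - \<sigma>)) \<le> C * (norm (\<sigma>' - \<sigma>))\<^sup>2"
    and newton: "y - (\<sigma> \<bullet> y) *\<^sub>R 1 + (\<sigma> \<bullet> m) *\<^sub>R \<delta> = - Gt F \<sigma> \<mu>"
  shows "norm (Gt F \<sigma>' \<mu> + Gt F \<sigma> \<mu> * \<delta>) \<le> (q + t * norm (1 :: real ^ 'n)) * (norm \<delta>)\<^sup>2"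
proof -
  \<comment> \<open>\<open>e\<close> is the first-order change of \<open>h\<close>.
    \<open>R1\<close>, \<open>R2\<close>, \<open>R3\<close> are the remainders of softmax, of the
    quotient and of \<open>F\<close>; \<open>Q\<close> and \<open>T\<close> collect the second-order
    parts of \<open>h\<close> and of its weighted mean.\<close>
  define h where "h = F \<sigma> - m"
  define m' where "m' = vdiv \<mu> \<sigma>'"
  define e where "e = F' (\<sigma> * \<delta>) + m * \<delta>"
  define R1 where "R1 = \<sigma>' - \<sigma> - \<sigma> * \<delta>"
  define R2 where "R2 = m' - (m - m * \<delta>)"
  define R3 where "R3 = F \<sigma>' - F \<sigma> - F' (\<sigma>' - \<sigma>)"
  define Q where "Q = F' R1 + R3 - R2"
  define T where "T = (\<sigma> * \<delta>) \<bullet> e + \<sigma>' \<bullet> Q + R1 \<bullet> (h + e)"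
  let ?D = "(norm \<delta>)\<^sup>2"
  have B0: "0 \<le> B" and Bm0: "0 \<le> Bm" and BF0: "0 \<le> BF" and L0: "0 \<le> L"
    using \<delta> m F F' norm_ge_zero order_trans by blast+
  have R0: "0 \<le> R" by (simp add: R_def)
  have n\<sigma>: "norm \<sigma> \<le> 1" "norm \<sigma>' \<le> 1"
    by (simp_all add: \<sigma>_def \<sigma>'_def norm_Simp_le_1 softmax_in_Simp)
  have \<sigma>\<delta>: "norm (\<sigma> * \<delta>) \<le> norm \<delta>"
    using norm_times_vec_le[of \<sigma> \<delta>] mult_right_mono[OF n\<sigma>(1), of "norm \<delta>"] by simp
  have R1: "norm R1 \<le> R * ?D"
    using softmax_linear_remainder[of \<theta> \<delta> B] orth \<delta> by (simp add: R1_def R_def \<sigma>_def \<sigma>'_def)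
  have R2: "norm R2 \<le> Bm * R * ?D"
  proof -
    have "norm R2 \<le> norm m * (R * ?D)"
      using vdiv_softmax_linear_remainder[of \<theta> \<delta> B \<mu>] orth \<delta>
      by (simp add: R2_def R_def \<sigma>_def \<sigma>'_def m_def m'_def)
    also have "\<dots> \<le> Bm * (R * ?D)" using m R0 by (intro mult_right_mono) auto
    finally show ?thesis by (simp add: mult.assoc)
  qed
  have R3: "norm R3 \<le> C * (1 + R * B)\<^sup>2 * ?D"
  proof -
    \<comment> \<open>One factor \<open>norm \<delta>\<close> of the quadratic remainder is traded
      for \<open>B\<close>, so the move of \<open>\<sigma>\<close> is linear in
      \<open>\<delta>\<close> and its square quadratic.\<close>
    have "norm (\<sigma>' - \<sigma>) \<le> norm (\<sigma> * \<delta>) + norm R1"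
      using norm_triangle_ineq[of "\<sigma> * \<delta>" R1] by (simp add: R1_def)
    also have "\<dots> \<le> norm \<delta> + R * (norm \<delta> * norm \<delta>)"
      using \<sigma>\<delta> R1 by (simp add: power2_eq_square)
    also have "\<dots> \<le> norm \<delta> + R * (B * norm \<delta>)"
      using R0 \<delta> by (intro add_left_mono mult_left_mono mult_right_mono) auto
    finally have "norm (\<sigma>' - \<sigma>) \<le> (1 + R * B) * norm \<delta>" by (simp add: algebra_simps)
    then have "(norm (\<sigma>' - \<sigma>))\<^sup>2 \<le> ((1 + R * B) * norm \<delta>)\<^sup>2" by (rule power_mono) simp
    then have "C * (norm (\<sigma>' - \<sigma>))\<^sup>2 \<le> C * ((1 + R * B) * norm \<delta>)\<^sup>2"
      using C by (rule mult_left_mono)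
    with taylor show ?thesis unfolding R3_def power_mult_distrib by linarith
  qed
  have F'R1: "norm (F' R1) \<le> L * R * ?D"
  proof -
    have "norm (F' R1) \<le> norm F' * norm R1" by (rule norm_blinfun)
    also have "\<dots> \<le> L * (R * ?D)" using F' R1 L0 by (intro mult_mono) auto
    finally show ?thesis by (simp add: mult.assoc)
  qed
  have Q: "norm Q \<le> q * ?D"
  proof -
    have "norm Q \<le> norm (F' R1) + norm R3 + norm R2"
      using norm_triangle_ineq4[of "F' R1 + R3" R2] norm_triangle_ineq[of "F' R1" R3]
      unfolding Q_def by linarith
    then show ?thesis using F'R1 R2 R3 by (simp add: q_def distrib_right)
  qed
  have e: "norm e \<le> (L + Bm) * norm \<delta>"
  proof -
    have "norm (F' (\<sigma> * \<delta>)) \<le> L * norm \<delta>"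
      using norm_blinfun[of F' "\<sigma> * \<delta>"] mult_mono[OF F' \<sigma>\<delta> L0 norm_ge_zero] by linarith
    moreover have "norm (m * \<delta>) \<le> Bm * norm \<delta>"
      using norm_times_vec_le[of m \<delta>] mult_right_mono[OF m, of "norm \<delta>"] by simp
    ultimately show ?thesis
      unfolding e_def distrib_right using norm_triangle_ineq[of "F' (\<sigma> * \<delta>)" "m * \<delta>"] by linarith
  qed
  have h: "norm h \<le> BF + Bm"
    unfolding h_def using norm_triangle_ineq4[of "F \<sigma>" m] F m by linarith
  have T: "\<bar>T\<bar> \<le> t * ?D"
  proof -
    have "\<bar>(\<sigma> * \<delta>) \<bullet> e\<bar> \<le> norm \<delta> * ((L + Bm) * norm \<delta>)"
      using Cauchy_Schwarz_ineq2[of "\<sigma> * \<delta>" e] mult_mono[OF \<sigma>\<delta> e] by simp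
    moreover have "\<bar>\<sigma>' \<bullet> Q\<bar> \<le> 1 * (q * ?D)"
      using Cauchy_Schwarz_ineq2[of \<sigma>' Q] mult_mono[OF n\<sigma>(2) Q] by simp
    \<comment> \<open>Boundedness suffices here, since \<open>R1\<close> is already
      quadratic.\<close>
    moreover have "norm (h + e) \<le> (BF + Bm) + (L + Bm) * B"
    proof -
      have "(L + Bm) * norm \<delta> \<le> (L + Bm) * B" using \<delta> L0 Bm0 by (intro mult_left_mono) auto
      then show ?thesis using norm_triangle_ineq[of h e] h e by linarith
    qed
    then have "\<bar>R1 \<bullet> (h + e)\<bar> \<le> (R * ?D) * ((BF + Bm) + (L + Bm) * B)"
      using Cauchy_Schwarz_ineq2[of R1 "h + e"] mult_mono[OF R1 _ _ norm_ge_zero] R0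
      by (meson mult_nonneg_nonneg order_trans zero_le_power2)
    ultimately have "\<bar>T\<bar> \<le> norm \<delta> * ((L + Bm) * norm \<delta>) + 1 * (q * ?D)
        + (R * ?D) * ((BF + Bm) + (L + Bm) * B)"
      unfolding T_def by linarith
    also have "\<dots> = t * ?D" by (simp add: t_def power2_eq_square algebra_simps)
    finally show ?thesis .
  qed
  have g: "Gt F \<sigma> \<mu> = h - (\<sigma> \<bullet> h) *\<^sub>R 1"
    unfolding h_def m_def by (rule Gt_eq) (simp add: \<sigma>_def softmax_pos)
  have g': "Gt F \<sigma>' \<mu> = (F \<sigma>' - m') - (\<sigma>' \<bullet> (F \<sigma>' - m')) *\<^sub>R 1"
    unfolding m'_def by (rule Gt_eq) (simp add: \<sigma>'_def softmax_pos)
  have split: "\<sigma>' = \<sigma> + \<sigma> * \<delta> + R1" by (simp add: R1_def)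
  have "F' (\<sigma>' - \<sigma>) = F' (\<sigma> * \<delta>) + F' R1"
    by (subst blinfun.add_right[symmetric]) (simp add: R1_def)
  then have h': "F \<sigma>' - m' = h + e + Q"
    by (simp add: h_def e_def Q_def R2_def R3_def)
  have "\<sigma>' \<bullet> (h + e + Q) = (\<sigma> + \<sigma> * \<delta> + R1) \<bullet> (h + e) + \<sigma>' \<bullet> Q"
    using split by (simp add: inner_add_right)
  then have ip: "\<sigma>' \<bullet> (h + e + Q) = \<sigma> \<bullet> h + (\<sigma> \<bullet> e + (\<sigma> * \<delta>) \<bullet> h) + T"
    by (simp add: T_def inner_add_right inner_add_left)
  \<comment> \<open>The Newton equation reduces all terms up to first order to this single
    product.\<close>
  have "Gt F \<sigma> \<mu> + e - (\<sigma> \<bullet> e + (\<sigma> * \<delta>) \<bullet> h) *\<^sub>R 1 = - (Gt F \<sigma> \<mu> * \<delta>)"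
    using newton_cancellation[OF orth newton[unfolded y_def g h_def]]
    by (simp add: g h_def e_def)
  then have eq: "Gt F \<sigma>' \<mu> + Gt F \<sigma> \<mu> * \<delta> = Q - T *\<^sub>R 1"
    unfolding g' h' ip by (simp add: g algebra_simps)
  have "norm (Q - T *\<^sub>R 1) \<le> norm Q + \<bar>T\<bar> * norm (1 :: real ^ 'n)"
    using norm_triangle_ineq4[of Q "T *\<^sub>R 1"] by simp
  moreover have "\<bar>T\<bar> * norm (1 :: real ^ 'n) \<le> t * ?D * norm (1 :: real ^ 'n)"
    using T by (rule mult_right_mono) simp
  ultimately have "norm (Gt F \<sigma>' \<mu> + Gt F \<sigma> \<mu> * \<delta>) \<le> q * ?D + t * ?D * norm (1 :: real ^ 'n)"
    unfolding eq using Q by linarith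
  then show ?thesis by (simp add: algebra_simps)
qed


section \<open>The Newton operator and its solutions\<close>

lemma bounded_bilinear_times_vec: "bounded_bilinear ((*) :: real ^ 'n \<Rightarrow> real ^ 'n \<Rightarrow> real ^ 'n)"
proof
  show "\<exists>K. \<forall>a b :: real ^ 'n. norm (a * b) \<le> norm a * norm b * K"
    using norm_times_vec_le by (intro exI[of _ 1]) auto
qed (simp_all add: vec_eq_iff algebra_simps)

text \<open>Joint continuity in the point and the vector, as the compactness argument for a uniform
  inverse bound requires.\<close>

lemma continuous_on_newton_operator:
  fixes F :: "real ^ 'n \<Rightarrow> real ^ 'n" and N :: "((real ^ 'n) \<times> (real ^ 'n)) set"
  assumes F': "\<And>x. x \<in> Simp \<Longrightarrow> (F has_derivative blinfun_apply (F' x)) (at x)"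
    and cont: "continuous_on Simp F'" and N: "fst ` N \<subseteq> Simp"
  shows "continuous_on (N \<times> UNIV) (\<lambda>((\<sigma>, \<mu>), v). (J F k \<sigma> + (1 \<bullet> \<mu>) *\<^sub>R mat 1) *v v)"
proof -
  have contF: "continuous_on Simp F"
    using F' by (meson continuous_at_imp_continuous_on has_derivative_continuous)
  have img: "fst (fst z) \<in> Simp" if "z \<in> N \<times> UNIV" for z :: "((real ^ 'n) \<times> (real ^ 'n)) \<times> (real ^ 'n)"
    using that N by auto
  have c1: "continuous_on (N \<times> (UNIV :: (real ^ 'n) set)) (\<lambda>z. fst (fst z))"
    by (intro continuous_intros)
  have c2: "continuous_on (N \<times> (UNIV :: (real ^ 'n) set)) (\<lambda>z. F (fst (fst z)))"
    "continuous_on (N \<times> (UNIV :: (real ^ 'n) set)) (\<lambda>z. F' (fst (fst z)))"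
    using img by (auto intro!: continuous_on_compose2[OF contF c1] continuous_on_compose2[OF cont c1])
  have "continuous_on (N \<times> UNIV) (\<lambda>z. let \<sigma> = fst (fst z); \<mu> = snd (fst z); v = snd z;
      w = v - (\<sigma> \<bullet> v) *\<^sub>R 1; y = F' \<sigma> (\<sigma> * w) + (F \<sigma> - (\<sigma> \<bullet> F \<sigma>) *\<^sub>R 1) * w
    in y - (\<sigma> \<bullet> y) *\<^sub>R 1 + (k * (\<sigma> \<bullet> v)) *\<^sub>R 1 + (1 \<bullet> \<mu>) *\<^sub>R v)"
    unfolding Let_def
    by (intro continuous_intros c2 bounded_bilinear.continuous_on[OF bounded_bilinear_times_vec])
  then show ?thesis
    by (rule continuous_on_eq)
      (use img in \<open>auto simp: Let_def J_mult_vec[OF F'] matrix_vector_mult_add_rdistrib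
        scaleR_matrix_vector_assoc[symmetric]\<close>)
qed

text \<open>Adding a kernel vector to the step gives another solution, against uniqueness.\<close>

lemma given_by_newton_equation_kernel:
  assumes "given_by_newton_equation F k N D" and "(\<sigma>, \<mu>) \<in> N"
    and "(J F k \<sigma> + (1 \<bullet> \<mu>) *\<^sub>R mat 1) *v v = 0"
  shows "v = 0"
proof -
  have iff: "newton_equation F k \<sigma> \<mu> \<delta> \<longleftrightarrow> \<delta> = D \<sigma> \<mu>" for \<delta>
    using assms(1,2) unfolding given_by_newton_equation_def by blast
  have "newton_equation F k \<sigma> \<mu> (D \<sigma> \<mu> + v)"
    using iff[of "D \<sigma> \<mu>"] assms(3) by (simp add: newton_equation_def matrix_vector_right_distrib)
  then show ?thesis using iff[of "D \<sigma> \<mu> + v"] by simp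
qed

text \<open>Pairing the equation with \<open>\<sigma>\<close> kills the projected terms and leaves
  \<open>(k + s) * (\<sigma> \<bullet> \<delta>) = 0\<close>.\<close>

lemma newton_step_orthogonal:
  fixes \<sigma> \<delta> y g :: "real ^ 'n"
  assumes "1 \<bullet> \<sigma> = 1" "k + s \<noteq> 0" "\<sigma> \<bullet> g = 0"
    and "y - (\<sigma> \<bullet> y) *\<^sub>R 1 + (k * (\<sigma> \<bullet> \<delta>)) *\<^sub>R 1 + s *\<^sub>R \<delta> = - g"
  shows "\<sigma> \<bullet> \<delta> = 0"
proof -
  have "\<sigma> \<bullet> 1 = 1" using assms(1) by (simp add: inner_commute)
  then have "(k + s) * (\<sigma> \<bullet> \<delta>) = \<sigma> \<bullet> (y - (\<sigma> \<bullet> y) *\<^sub>R 1 + (k * (\<sigma> \<bullet> \<delta>)) *\<^sub>R 1 + s *\<^sub>R \<delta>)"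
    by (simp add: inner_add_right inner_diff_right distrib_right)
  also have "\<dots> = 0" unfolding assms(4) using assms(3) by simp
  finally show ?thesis using assms(2) by simp
qed

section \<open>Assembly of the quadratic estimate\<close>

theorem proposition12:
  fixes F :: "real ^ 'n \<Rightarrow> real ^ 'n"
    and \<Gamma> :: "((real ^ 'n) \<times> (real ^ 'n)) set"
    and \<sigma>star :: "real ^ 'n"
    and k \<zeta> d :: real
    and D :: "real ^ 'n \<Rightarrow> real ^ 'n \<Rightarrow> real ^ 'n"
  assumes F_C1: "C1_near Simp F"
    and path: "path_on_bundle F \<Gamma> \<sigma>star"
    and k_nonzero: "k \<noteq> 0"
    and k_shift: "\<forall>(\<sigma>, \<mu>)\<in>Nbhd \<Gamma> d \<zeta>. k + 1 \<bullet> \<mu> \<noteq> 0"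
    and path_S: "\<Gamma> \<inter> S F k \<subseteq> {(\<sigma>star, 0)}"
    and zeta_nonneg: "0 \<le> \<zeta>"
    and zeta_singular: "\<not> invertible (J F k \<sigma>star) \<Longrightarrow> \<zeta> \<noteq> 0"
    and d_pos: "0 < d"
    and nbhd_S: "Nbhd \<Gamma> d \<zeta> \<inter> S F k = {}"
    and F_C2: "C2_near (fst ` Nbhd \<Gamma> d \<zeta>) F"
    and newton: "given_by_newton_equation F k (Nbhd \<Gamma> d \<zeta>) D"
  shows "\<exists>C1>0. \<forall>\<theta> \<mu>. (softmax \<theta>, \<mu>) \<in> Nbhd \<Gamma> d \<zeta> \<longrightarrow>
           norm (Gt F (softmax (\<theta> + D (softmax \<theta>) \<mu>)) \<mu>)
             \<le> C1 * (norm (Gt F (softmax \<theta>) \<mu>))\<^sup>2"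
proof -
  define N where "N = Nbhd \<Gamma> d \<zeta>"
  obtain F' where F': "\<And>x. x \<in> Simp \<Longrightarrow> (F has_derivative blinfun_apply (F' x)) (at x)"
    and contF': "continuous_on Simp F'"
  proof -
    obtain U F' where "Simp \<subseteq> U" "\<forall>x\<in>U. (F has_derivative blinfun_apply (F' x)) (at x)"
      "continuous_on U F'"
      using F_C1 unfolding C1_near_def C1_on_def by blast
    then show thesis by (intro that[of F']) (auto intro: continuous_on_subset)
  qed
  have contF: "continuous_on Simp F"
    using F' by (meson continuous_at_imp_continuous_on has_derivative_continuous)
  obtain B where B: "0 \<le> B" and N: "\<And>\<sigma> \<mu>. (\<sigma>, \<mu>) \<in> N \<Longrightarrow>
      \<sigma> \<in> Simp \<and> norm \<mu> \<le> B \<and> (\<forall>i. \<bar>\<mu> $ i\<bar> \<le> B * \<sigma> $ i)"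
    unfolding N_def using Nbhd_bounds[OF path contF zeta_nonneg] by metis
  have fst_N: "fst ` N \<subseteq> Simp" using N by force
  have "compact N"
  proof -
    have "N \<subseteq> Simp \<times> cball 0 B" using N by auto
    moreover have "bounded (Simp \<times> cball (0 :: real ^ 'n) B)"
      by (intro bounded_Times compact_imp_bounded[OF compact_Simp] bounded_cball)
    ultimately show ?thesis
      by (auto simp: compact_eq_bounded_closed N_def Nbhd_def intro: bounded_subset)
  qed
  have "compact (fst ` N)"
    by (intro compact_continuous_image \<open>compact N\<close> continuous_intros)
  \<comment> \<open>The second point ranges over the whole simplex because the Newton step may leave
    the neighborhood.\<close>
  then obtain C where C: "0 \<le> C" and taylor: "\<And>x y. x \<in> fst ` N \<Longrightarrow> y \<in> Simp \<Longrightarrow>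
      norm (F y - F x - F' x (y - x)) \<le> C * (norm (y - x))\<^sup>2"
    using C2_near_taylor_bound[OF _ F_C2[folded N_def] compact_Simp fst_N contF, of F'] F' fst_N
    by blast
  obtain BF where BF: "0 < BF" "\<And>z. z \<in> Simp \<Longrightarrow> norm (F z) \<le> BF"
    using compact_imp_bounded[OF compact_continuous_image[OF contF compact_Simp]]
    unfolding bounded_pos by auto
  obtain L where L: "0 < L" "\<And>z. z \<in> Simp \<Longrightarrow> norm (F' z) \<le> L"
    using compact_imp_bounded[OF compact_continuous_image[OF contF' compact_Simp]]
    unfolding bounded_pos by auto
  \<comment> \<open>The Newton operator with its arguments as one tuple; injectivity at each point
    of \<open>N\<close> becomes one constant \<open>c\<close> for all of \<open>N\<close>.\<close>
  define h :: "((real ^ 'n) \<times> (real ^ 'n)) \<times> (real ^ 'n) \<Rightarrow> real ^ 'n"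
    where "h = (\<lambda>((\<sigma>, \<mu>), v). (J F k \<sigma> + (1 \<bullet> \<mu>) *\<^sub>R mat 1) *v v)"
  have "continuous_on (N \<times> UNIV) h"
    unfolding h_def by (rule continuous_on_newton_operator[OF F' contF' fst_N])
  moreover have "h (x, v) \<noteq> 0" if "x \<in> N" "v \<noteq> 0" for x v
    using that given_by_newton_equation_kernel[OF newton[folded N_def]]
    by (cases x) (auto simp: h_def)
  moreover have "h (x, s *\<^sub>R v) = s *\<^sub>R h (x, v)" for x v s
    by (cases x) (simp add: h_def matrix_vector_mult_scaleR)
  ultimately obtain c where c: "0 < c" and "\<And>x v. x \<in> N \<Longrightarrow> c * norm v \<le> norm (h (x, v))"
    using compact_injective_lower_bound[OF \<open>compact N\<close>, of h] by blast
  then have lower: "c * norm v \<le> norm ((J F k \<sigma> + (1 \<bullet> \<mu>) *\<^sub>R mat 1) *v v)"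
    if "(\<sigma>, \<mu>) \<in> N" for \<sigma> \<mu> v
    using that by (force simp: h_def)
  \<comment> \<open>A priori bounds for \<open>m\<close>, \<open>g\<close> and
    \<open>\<delta>\<close> in turn. The bound on the step comes first because the exponential
    constants below depend on it.\<close>
  define Bm where "Bm = norm (B *\<^sub>R 1 :: real ^ 'n)"
  define Bg where "Bg = (BF + Bm) + (BF + Bm) * norm (1 :: real ^ 'n)"
  define B\<delta> where "B\<delta> = Bg / c"
  define R where "R = exp B\<delta> + exp B\<delta> * exp B\<delta>"
  define q where "q = L * R + C * (1 + R * B\<delta>)\<^sup>2 + Bm * R"
  define t where "t = (L + Bm) + q + R * ((BF + Bm) + (L + Bm) * B\<delta>)"
  define C' where "C' = q + t * norm (1 :: real ^ 'n)"
  have Bm0: "0 \<le> Bm" by (simp add: Bm_def)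
  have "0 \<le> C'"
    using Bm0 BF(1) L(1) C c by (simp add: C'_def t_def q_def R_def B\<delta>_def Bg_def)
  \<comment> \<open>\<open>1 / c\<close> comes from the leftover product
    \<open>g * \<delta>\<close>, and \<open>C' / c\<^sup>2\<close> from the quadratic remainder with
    \<open>norm \<delta> \<le> norm g / c\<close>.\<close>
  have main: "norm (Gt F (softmax (\<theta> + D (softmax \<theta>) \<mu>)) \<mu>)
      \<le> (1 / c + C' / c\<^sup>2) * (norm (Gt F (softmax \<theta>) \<mu>))\<^sup>2"
    if in_N: "(softmax \<theta>, \<mu>) \<in> N" for \<theta> \<mu>
  proof -
    define \<sigma> where "\<sigma> = softmax \<theta>"
    define \<delta> where "\<delta> = D \<sigma> \<mu>"
    define m where "m = vdiv \<mu> \<sigma>"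
    define g where "g = Gt F \<sigma> \<mu>"
    define y where "y = F' \<sigma> (\<sigma> * \<delta>) + (F \<sigma> - (\<sigma> \<bullet> F \<sigma>) *\<^sub>R 1) * \<delta>"
    have \<sigma>N: "(\<sigma>, \<mu>) \<in> N" using in_N by (simp add: \<sigma>_def)
    have Simp: "\<sigma> \<in> Simp" by (simp add: \<sigma>_def softmax_in_Simp)
    have pos: "0 < \<sigma> $ i" for i by (simp add: \<sigma>_def softmax_pos)
    have sum1: "1 \<bullet> \<sigma> = 1" using Simp by (simp add: Simp_def)
    have m: "norm m \<le> Bm"
      unfolding Bm_def
    proof (rule norm_le_componentwise_cart)
      fix i show "norm (m $ i) \<le> norm ((B *\<^sub>R 1 :: real ^ 'n) $ i)"
        using N[OF \<sigma>N] pos[of i] B by (auto simp: m_def vdiv_def abs_divide divide_le_eq)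
    qed
    \<comment> \<open>Identifies the shift \<open>1 \<bullet> \<mu>\<close> of the Newton matrix
      with the coefficient \<open>\<sigma> \<bullet> m\<close> in the cancellation.\<close>
    have "\<mu> = \<sigma> * m" using pos by (simp add: m_def vdiv_def vec_eq_iff less_imp_neq[symmetric])
    then have sum_\<mu>: "1 \<bullet> \<mu> = \<sigma> \<bullet> m" by (simp add: inner_mult_left_one)
    have g: "g = (F \<sigma> - m) - (\<sigma> \<bullet> (F \<sigma> - m)) *\<^sub>R 1"
      unfolding g_def m_def by (rule Gt_eq[OF pos])
    have "newton_equation F k \<sigma> \<mu> \<delta>"
      using newton \<sigma>N unfolding given_by_newton_equation_def N_def \<delta>_def by blast
    then have step: "(J F k \<sigma> + (1 \<bullet> \<mu>) *\<^sub>R mat 1) *v \<delta> = - g"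
      by (simp add: newton_equation_def one_minus_outer_mult_vec g m_def)
    \<comment> \<open>\<open>J\<close> acts through the projection \<open>w\<close> of
      \<open>\<delta>\<close>; orthogonality, known only afterwards, gives
      \<open>w = \<delta>\<close> and \<open>z = y\<close>.\<close>
    define w where "w = \<delta> - (\<sigma> \<bullet> \<delta>) *\<^sub>R 1"
    define z where "z = F' \<sigma> (\<sigma> * w) + (F \<sigma> - (\<sigma> \<bullet> F \<sigma>) *\<^sub>R 1) * w"
    have step': "z - (\<sigma> \<bullet> z) *\<^sub>R 1 + (k * (\<sigma> \<bullet> \<delta>)) *\<^sub>R 1 + (1 \<bullet> \<mu>) *\<^sub>R \<delta> = - g"
      using step by (simp add: matrix_vector_mult_add_rdistrib J_mult_vec[OF F'[OF Simp]] Let_def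
          scaleR_matrix_vector_assoc[symmetric] z_def w_def)
    have "\<sigma> \<bullet> 1 = 1" using sum1 by (simp add: inner_commute)
    then have "\<sigma> \<bullet> g = 0" unfolding g by (simp add: inner_diff_right)
    then have orth: "\<sigma> \<bullet> \<delta> = 0"
      using newton_step_orthogonal[OF sum1 _ _ step'] k_shift \<sigma>N by (auto simp: N_def)
    then have "z = y" by (simp add: z_def w_def y_def)
    with step' orth have step'': "y - (\<sigma> \<bullet> y) *\<^sub>R 1 + (\<sigma> \<bullet> m) *\<^sub>R \<delta> = - g"
      by (simp add: sum_\<mu>)
    have \<delta>_g: "norm \<delta> \<le> norm g / c"
      using lower[OF \<sigma>N, of \<delta>] c by (simp add: step field_simps)
    have "norm g \<le> Bg"
    proof -
      have h: "norm (F \<sigma> - m) \<le> BF + Bm"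
        using norm_triangle_ineq4[of "F \<sigma>" m] BF(2)[OF Simp] m by linarith
      have "\<bar>\<sigma> \<bullet> (F \<sigma> - m)\<bar> \<le> 1 * (BF + Bm)"
        using Cauchy_Schwarz_ineq2[of \<sigma> "F \<sigma> - m"] mult_mono[OF norm_Simp_le_1[OF Simp] h] by simp
      then have "norm ((\<sigma> \<bullet> (F \<sigma> - m)) *\<^sub>R (1 :: real ^ 'n)) \<le> (BF + Bm) * norm (1 :: real ^ 'n)"
        by (simp add: mult_right_mono)
      then show ?thesis
        unfolding g Bg_def using h norm_triangle_ineq4 by (meson add_mono order_trans)
    qed
    then have \<delta>_B: "norm \<delta> \<le> B\<delta>"
      using \<delta>_g c unfolding B\<delta>_def by (meson divide_right_mono less_imp_le order_trans)
    have "norm (Gt F (softmax (\<theta> + \<delta>)) \<mu> + g * \<delta>) \<le> C' * (norm \<delta>)\<^sup>2"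
      unfolding C'_def t_def q_def R_def g_def \<sigma>_def
    proof (rule newton_step_remainder)
      show "norm (F (softmax (\<theta> + \<delta>)) - F (softmax \<theta>)
          - F' (softmax \<theta>) (softmax (\<theta> + \<delta>) - softmax \<theta>))
        \<le> C * (norm (softmax (\<theta> + \<delta>) - softmax \<theta>))\<^sup>2"
        using \<sigma>N by (intro taylor softmax_in_Simp) (force simp: \<sigma>_def)
    qed (use orth \<delta>_B m BF(2)[OF Simp] L(2)[OF Simp] C step'' in
        \<open>simp_all add: \<sigma>_def m_def y_def g_def\<close>)
    moreover have "norm (g * \<delta>) \<le> (norm g)\<^sup>2 / c"
      using norm_times_vec_le[of g \<delta>] mult_left_mono[OF \<delta>_g, of "norm g"]
      by (simp add: power2_eq_square)
    moreover have "C' * (norm \<delta>)\<^sup>2 \<le> C' * ((norm g)\<^sup>2 / c\<^sup>2)"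
      using power_mono[OF \<delta>_g, of 2] \<open>0 \<le> C'\<close> by (intro mult_left_mono) (auto simp: power_divide)
    moreover have "norm (Gt F (softmax (\<theta> + \<delta>)) \<mu>)
        \<le> norm (Gt F (softmax (\<theta> + \<delta>)) \<mu> + g * \<delta>) + norm (g * \<delta>)"
      using norm_triangle_ineq4[of "Gt F (softmax (\<theta> + \<delta>)) \<mu> + g * \<delta>" "g * \<delta>"] by simp
    ultimately have "norm (Gt F (softmax (\<theta> + \<delta>)) \<mu>) \<le> (norm g)\<^sup>2 / c + C' * ((norm g)\<^sup>2 / c\<^sup>2)"
      by linarith
    then show ?thesis by (simp add: g_def \<delta>_def \<sigma>_def distrib_right)
  qed
  moreover have "0 < 1 / c + C' / c\<^sup>2"
    using c \<open>0 \<le> C'\<close> by (simp add: add_pos_nonneg)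
  ultimately show ?thesis unfolding N_def by blast
qed

end
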